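(* Let $X$ be a sequentially Hausdorff topological space, let $Y$ be a Hausdorff topological space, and let $f:X\to Y$ be a compact-preserving function. (1) If $X$ is Fréchet, then the restriction $f|LI'_f$ of $f$ to the subspace $LI'_f\subset X$ is continuous. (2) If $X$ is strong Fréchet, then the restriction $f|LI_f$ of $f$ to the subspace $LI_f\subset X$ is continuous.
   Context: A function $f:X\to Y$ between topological spaces (not assumed continuous) is compact-preserving if the image $f(K)$ of each compact subset $K\subset X$ is compact. Compact means that every open cover has a finite subcover (no separation axiom included). A topological space $X$ is sequentially Hausdorff if each convergent sequence in $X$ has a unique limit. It is Fréchet if for each subset $A\subset X$ and each point $a\in\bar A$ there is a sequence of points of $A$ that converges to $a$. It is strong Fréchet if for any decreasing sequence $(A_n)_{n\in\omega}$ of subsets of $X$ and any point $a\in\bigcap_{n\in\omega}\bar A_n$ there is a sequence of points $a_n\in A_n$, $n\in\omega$, that converges to $a$. A function $f:X\to Y$ is locally finite at $x\in X$ if for some neighborhood $O_x\subset X$ of $x$ the image $f(O_x)$ is finite; it is locally infinite at $x$ if it is not locally finite at $x$. $LI_f$ denotes the set of points $x\in X$ at which $f$ is locally infinite, and $LI'_f$ denotes the set of non-isolated points of the subspace $LI_f$. *)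

theory Defs
  imports "HOL-Analysis.Analysis"
begin

definition sequentially_Hausdorff :: "'a topology \<Rightarrow> bool" where
  "sequentially_Hausdorff X \<longleftrightarrow>
     (\<forall>s l m. range s \<subseteq> topspace X \<and> limitin X s l sequentially \<and> limitin X s m sequentially
        \<longrightarrow> l = m)"

definition Frechet_space :: "'a topology \<Rightarrow> bool" where
  "Frechet_space X \<longleftrightarrow>
     (\<forall>A a. A \<subseteq> topspace X \<and> a \<in> X closure_of A
        \<longrightarrow> (\<exists>s. range s \<subseteq> A \<and> limitin X s a sequentially))"

definition strong_Frechet_space :: "'a topology \<Rightarrow> bool" where
  "strong_Frechet_space X \<longleftrightarrow>
     (\<forall>(A :: nat \<Rightarrow> 'a set) a. decseq A \<and> (\<forall>n. A n \<subseteq> topspace X) \<and> a \<in> (\<Inter>n. X closure_of A n)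
        \<longrightarrow> (\<exists>s. (\<forall>n. s n \<in> A n) \<and> limitin X s a sequentially))"

definition compact_preserving_map :: "'a topology \<Rightarrow> 'b topology \<Rightarrow> ('a \<Rightarrow> 'b) \<Rightarrow> bool" where
  "compact_preserving_map X Y f \<longleftrightarrow>
     f \<in> topspace X \<rightarrow> topspace Y \<and> (\<forall>K. compactin X K \<longrightarrow> compactin Y (f ` K))"

definition locally_finite_map_at :: "'a topology \<Rightarrow> ('a \<Rightarrow> 'b) \<Rightarrow> 'a \<Rightarrow> bool" where
  "locally_finite_map_at X f x \<longleftrightarrow> (\<exists>U. openin X U \<and> x \<in> U \<and> finite (f ` U))"

definition LI :: "'a topology \<Rightarrow> ('a \<Rightarrow> 'b) \<Rightarrow> 'a set" where
  "LI X f = {x \<in> topspace X. \<not> locally_finite_map_at X f x}"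

definition LI' :: "'a topology \<Rightarrow> ('a \<Rightarrow> 'b) \<Rightarrow> 'a set" where
  "LI' X f = {x \<in> LI X f. \<not> openin (subtopology X (LI X f)) {x}}"

end

theory Submission
  imports Defs
begin

text \<open>Call \<open>x\<close> a spreading point if some sequence converging to \<open>x\<close> has infinitely many
  \<open>f\<close>-values. Compactness of the images of convergent sequences shows that all but finitely
  many of these values lie in any given neighbourhood of \<open>f x\<close>. If \<open>f\<close> were discontinuous at
  \<open>x\<close> along spreading points \<open>t n\<close>, a Frechet diagonal argument applied to the sequences around
  the \<open>t n\<close> would yield a sequence converging to \<open>x\<close> with infinitely many values away from \<open>f x\<close>.
  It remains to see that the points in question are spreading. A locally infinite point that is
  not spreading lies in the closure of infinitely many fibres; strong Frechetness merges these
  fibres into one sequence, and at a point of \<open>LI'\<close> the diagonal argument works again.\<close>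

definition spreading_points :: "'a topology \<Rightarrow> ('a \<Rightarrow> 'b) \<Rightarrow> 'a set" where
  "spreading_points X f =
     {x. \<exists>s. range s \<subseteq> topspace X \<and> limitin X s x sequentially \<and> infinite (f ` range s)}"

section \<open>Closures and limits of sequences\<close>

lemma limitin_range_imp_closure_of:
  assumes "limitin X s x sequentially"
  shows "x \<in> X closure_of range s"
  unfolding in_closure_of
proof (intro conjI allI impI)
  show "x \<in> topspace X"
    using assms limitin_topspace by metis
next
  fix T assume "x \<in> T \<and> openin X T"
  with assms have "eventually (\<lambda>n. s n \<in> T) sequentially"
    by (simp add: limitin_def)
  then show "\<exists>y. y \<in> range s \<and> y \<in> T"
    by (meson eventually_sequentially order_refl rangeI)
qed

lemma limitin_frequently_imp_closure_of:
  assumes lim: "limitin X s x sequentially" and inf: "infinite {n. s n \<in> A}"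
  shows "x \<in> X closure_of A"
  unfolding in_closure_of
proof (intro conjI allI impI)
  show "x \<in> topspace X"
    using lim limitin_topspace by metis
next
  fix T assume "x \<in> T \<and> openin X T"
  with lim obtain N where N: "\<And>n. n \<ge> N \<Longrightarrow> s n \<in> T"
    by (auto simp: limitin_def eventually_sequentially)
  obtain n where "n \<ge> N" "s n \<in> A"
    using inf unfolding infinite_nat_iff_unbounded_le by blast
  with N show "\<exists>y. y \<in> A \<and> y \<in> T"
    by blast
qed

lemma closure_of_finite_UN:
  "finite I \<Longrightarrow> X closure_of (\<Union>i\<in>I. A i) = (\<Union>i\<in>I. X closure_of A i)"
  by (simp add: closure_of_Union)

lemma Frechet_spaceE:
  assumes "Frechet_space X" "A \<subseteq> topspace X" "a \<in> X closure_of A"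
  obtains s where "range s \<subseteq> A" "limitin X s a sequentially"
  using assms unfolding Frechet_space_def by blast

lemma sequentially_HausdorffD:
  assumes "sequentially_Hausdorff X" "range s \<subseteq> topspace X"
    "limitin X s l sequentially" "limitin X s m sequentially"
  shows "l = m"
  using assms unfolding sequentially_Hausdorff_def by blast

lemma strong_Frechet_imp_Frechet_space:
  assumes "strong_Frechet_space X"
  shows "Frechet_space X"
  unfolding Frechet_space_def
proof (intro allI impI)
  fix A a
  assume "A \<subseteq> topspace X \<and> a \<in> X closure_of A"
  moreover have "decseq (\<lambda>n::nat. A)"
    by (simp add: decseq_def)
  ultimately have "\<exists>s. (\<forall>n::nat. s n \<in> A) \<and> limitin X s a sequentially"
    using assms[unfolded strong_Frechet_space_def, rule_format, of "\<lambda>n. A" a] by simp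
  then show "\<exists>s. range s \<subseteq> A \<and> limitin X s a sequentially"
    by blast
qed

text \<open>A point adherent to \<open>{x}\<close> is the limit of a sequence in \<open>{x}\<close>.
  That sequence is constant and also converges to \<open>x\<close>, so uniqueness of limits
  applies.\<close>

lemma sequentially_Hausdorff_Frechet_imp_t1_space:
  assumes "sequentially_Hausdorff X" "Frechet_space X"
  shows "t1_space X"
  unfolding t1_space_closedin_singleton
proof
  fix x assume x: "x \<in> topspace X"
  have "X closure_of {x} \<subseteq> {x}"
  proof
    fix y assume "y \<in> X closure_of {x}"
    then obtain s :: "nat \<Rightarrow> 'a" where s: "range s \<subseteq> {x}" "limitin X s y sequentially"
      using Frechet_spaceE[OF assms(2), of "{x}"] x by blast
    then have "s = (\<lambda>n. x)"
      by auto
    then have "limitin X s x sequentially"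
      using x by simp
    then show "y \<in> {x}"
      using sequentially_HausdorffD[OF assms(1) _ s(2)] s(1) x by blast
  qed
  then show "closedin X {x}"
    using x closure_of_subset_eq[of "{x}" X] by simp
qed

lemma closure_of_range_convergent:
  assumes sH: "sequentially_Hausdorff X" and Fr: "Frechet_space X"
    and y: "range y \<subseteq> topspace X" "limitin X y t sequentially"
    and x: "x \<in> X closure_of range y" "x \<notin> range y"
  shows "x = t"
proof -
  obtain b where b: "range b \<subseteq> range y" and limb: "limitin X b x sequentially"
    using Frechet_spaceE[OF Fr y(1) x(1)] .
  then have "\<forall>i. \<exists>n. b i = y n"
    by blast
  then obtain k where k: "\<And>i. b i = y (k i)"
    by metis
  have "filterlim k at_top sequentially"
    unfolding filterlim_at_top
  proof
    fix N
    have "closedin X (y ` {..<N})"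
      using sequentially_Hausdorff_Frechet_imp_t1_space[OF sH Fr] y(1)
      by (auto simp: t1_space_closedin_finite)
    then have "openin X (topspace X - y ` {..<N})"
      by blast
    moreover have "x \<in> topspace X - y ` {..<N}"
      using x limb limitin_topspace by fastforce
    ultimately have "\<forall>\<^sub>F i in sequentially. b i \<in> topspace X - y ` {..<N}"
      using limb unfolding limitin_def by blast
    then show "\<forall>\<^sub>F i in sequentially. N \<le> k i"
      by eventually_elim (auto simp: k not_less[symmetric])
  qed
  then have "limitin X (\<lambda>i. y (k i)) t sequentially"
    using y(2) unfolding limitin_def filterlim_iff by blast
  then have "limitin X b t sequentially"
    by (simp flip: k)
  then show ?thesis
    using sequentially_HausdorffD[OF sH _ limb] b y(1) by blast
qed

section \<open>Values of the map along a convergent sequence\<close>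

text \<open>If infinitely many values lay outside \<open>U\<close>, they would form a compact
  infinite set \<open>D\<close> all of whose subsets are closed, which contradicts the
  Bolzano-Weierstrass property.\<close>

lemma finite_image_convergent_outside:
  assumes Y: "Hausdorff_space Y" and f: "compact_preserving_map X Y f"
    and s: "range s \<subseteq> topspace X" "limitin X s x sequentially"
    and U: "openin Y U" "f x \<in> U"
  shows "finite (f ` range s - U)"
proof (rule ccontr)
  define D where "D = f ` range s - U"
  assume "infinite (f ` range s - U)"
  then have inf: "infinite D"
    by (simp add: D_def)
  \<comment> \<open>As \<open>B\<close> varies, \<open>D - B\<close> runs through all subsets of
    \<open>D\<close>. The terms with values in \<open>D - B\<close> form a compact set together with
    the limit \<open>x\<close>.\<close>
  have "compactin Y (insert (f x) (D - B))" for B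
  proof -
    define T where "T = {z \<in> range s. f z \<in> D - B}"
    have "compactin X (insert x T)"
      by (rule compactin_sequence_with_limit[OF s(2)]) (use s in \<open>auto simp: T_def\<close>)
    then have "compactin Y (f ` insert x T)"
      using f by (auto simp: compact_preserving_map_def)
    moreover have "f ` insert x T = insert (f x) (D - B)"
      by (auto simp: T_def D_def)
    ultimately show ?thesis
      by simp
  qed
  note comp = this
  have closed: "closedin Y (D - B)" for B
  proof -
    \<comment> \<open>Subtracting the open set \<open>U\<close> discards just the extra point
      \<open>f x\<close> and leaves a closed set.\<close>
    have "D - B = insert (f x) (D - B) - U"
      using U by (auto simp: D_def)
    then show ?thesis
      using closedin_diff[OF compactin_imp_closedin[OF Y comp] U(1)] by metis
  qed
  have "closedin Y D"
    using closed[of "{}"] by simp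
  then have "compactin Y D"
    using comp[of "{}"] closed_compactin by fastforce
  then obtain y where y: "y \<in> D" "y \<in> Y derived_set_of D"
    using compactin_imp_Bolzano_Weierstrass[of Y D D] inf by blast
  \<comment> \<open>No point accumulates at itself, so \<open>y\<close> is an accumulation point of
    \<open>D - {y}\<close>, although this set is closed and misses \<open>y\<close>.\<close>
  have "Y derived_set_of D = Y derived_set_of (D - {y}) \<union> Y derived_set_of {y}"
    using y(1) by (metis derived_set_of_Un Un_Diff_cancel2 Un_absorb2 empty_subsetI insert_subset)
  then have "y \<in> Y derived_set_of (D - {y})"
    using y(2) by (auto simp: in_derived_set_of)
  then show False
    using closed[of "{y}"] by (auto simp: closedin_contains_derived_set)
qed

section \<open>The diagonal argument\<close>

text \<open>If a sequence drawn from the rows took only finitely many values, \<open>fin\<close>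
  would confine it to finitely many rows. Its limit \<open>x\<close> would then be adherent to a
  single sequence \<open>y n\<close> that avoids \<open>x\<close>, forcing
  \<open>x = t n\<close>.\<close>

lemma diagonal_infinite_image:
  assumes sH: "sequentially_Hausdorff X" and Fr: "Frechet_space X"
    and t: "limitin X t x sequentially" "\<And>n. t n \<noteq> x"
    and R: "\<And>n. R n \<subseteq> topspace X" "\<And>n. t n \<in> X closure_of R n"
    and fin: "\<And>d. finite {n::nat. d \<in> f ` R n}"
  obtains a where "range a \<subseteq> (\<Union>n. R n)" "limitin X a x sequentially" "infinite (f ` range a)"
proof -
  have x: "x \<in> topspace X"
    using t(1) limitin_topspace by metis
  \<comment> \<open>With \<open>x\<close> removed from the rows,
    \<open>closure_of_range_convergent\<close> will apply to \<open>x\<close> and the sequence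
    \<open>y n\<close>.\<close>
  have cl: "t n \<in> X closure_of (R n - {x})" for n
    unfolding in_closure_of
  proof (intro conjI allI impI)
    show "t n \<in> topspace X"
      using R(2) by (simp add: in_closure_of)
  next
    fix T assume T: "t n \<in> T \<and> openin X T"
    have "closedin X {x}"
      using sequentially_Hausdorff_Frechet_imp_t1_space[OF sH Fr] x t1_space_closedin_singleton
      by metis
    with T have "openin X (T - {x})"
      by blast
    moreover have "t n \<in> T - {x}"
      using T t(2) by simp
    ultimately have "\<exists>y. y \<in> R n \<and> y \<in> T - {x}"
      using R(2)[of n] unfolding in_closure_of by metis
    then show "\<exists>y. y \<in> R n - {x} \<and> y \<in> T"
      by blast
  qed
  have "\<exists>s. range s \<subseteq> R n - {x} \<and> limitin X s (t n) sequentially" for n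
    by (rule Frechet_spaceE[OF Fr _ cl]) (use R(1) in blast)+
  then obtain y :: "nat \<Rightarrow> nat \<Rightarrow> 'a"
    where y: "\<And>n. range (y n) \<subseteq> R n - {x}" "\<And>n. limitin X (y n) (t n) sequentially"
    by metis
  have x_cl: "x \<in> X closure_of (\<Union>n. range (y n))"
  proof -
    have "t n \<in> X closure_of (\<Union>n. range (y n))" for n
      using limitin_range_imp_closure_of[OF y(2)[of n]] closure_of_mono[of "range (y n)" "\<Union>n. range (y n)" X]
      by blast
    then have "range t \<subseteq> X closure_of (\<Union>n. range (y n))"
      by blast
    then have "X closure_of range t \<subseteq> X closure_of (\<Union>n. range (y n))"
      by (rule closure_of_minimal) (rule closedin_closure_of)
    then show ?thesis
      using limitin_range_imp_closure_of[OF t(1)] by blast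
  qed
  have "(\<Union>n. range (y n)) \<subseteq> topspace X"
    using y(1) R(1) by blast
  then obtain a where a: "range a \<subseteq> (\<Union>n. range (y n))" "limitin X a x sequentially"
    using Frechet_spaceE[OF Fr _ x_cl] by blast
  have "infinite (f ` range a)"
  proof
    assume fina: "finite (f ` range a)"
    define N where "N = (\<Union>d\<in>f ` range a. {n. d \<in> f ` R n})"
    have "finite N"
      unfolding N_def using fina fin by blast
    have "range a \<subseteq> (\<Union>n\<in>N. range (y n))"
    proof
      fix z assume z: "z \<in> range a"
      then obtain n where n: "z \<in> range (y n)"
        using a(1) by blast
      then have "n \<in> N"
        using z y(1)[of n] unfolding N_def by blast
      with n show "z \<in> (\<Union>n\<in>N. range (y n))"
        by blast
    qed
    then have "x \<in> X closure_of (\<Union>n\<in>N. range (y n))"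
      using limitin_range_imp_closure_of[OF a(2)] closure_of_mono by blast
    then obtain n where n: "x \<in> X closure_of (range (y n))"
      by (auto simp: closure_of_finite_UN[OF \<open>finite N\<close>])
    have "x = t n"
      by (rule closure_of_range_convergent[OF sH Fr _ y(2) n]) (use y(1)[of n] R(1)[of n] in blast)+
    then show False
      using t(2) by metis
  qed
  moreover have "range a \<subseteq> (\<Union>n. R n)"
    using a(1) y(1) by blast
  ultimately show thesis
    using that a(2) by blast
qed

text \<open>The set \<open>V\<close> controls where the new values lie: away from \<open>f x\<close>
  in the continuity proof, or anywhere in \<open>Y\<close> when only spreading of \<open>x\<close>
  is wanted.\<close>

lemma limit_of_spreading_points:
  assumes sH: "sequentially_Hausdorff X" and Fr: "Frechet_space X"
    and Y: "Hausdorff_space Y" and f: "compact_preserving_map X Y f"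
    and t: "limitin X t x sequentially" "\<And>n. t n \<noteq> x" "\<And>n. t n \<in> spreading_points X f"
    and V: "openin Y V" "\<And>n. f (t n) \<in> V"
  obtains a where "range a \<subseteq> topspace X" "limitin X a x sequentially"
    "infinite (f ` range a)" "f ` range a \<subseteq> V"
proof -
  have "\<exists>s. range s \<subseteq> topspace X \<and> limitin X s (t n) sequentially \<and> infinite (f ` range s)" for n
    using t(3)[of n] by (simp add: spreading_points_def)
  then obtain z :: "nat \<Rightarrow> nat \<Rightarrow> 'a" where z: "\<And>n. range (z n) \<subseteq> topspace X"
      "\<And>n. limitin X (z n) (t n) sequentially" "\<And>n. infinite (f ` range (z n))"
    by metis
  define E where "E = (\<Union>n. f ` range (z n))"
  have E: "countable E"
    unfolding E_def by blast
  \<comment> \<open>Row \<open>n\<close> avoids the first \<open>n + 1\<close> values of \<open>E\<close>, so each value occurs in finitely many rows.\<close>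
  define R where "R n = {w \<in> range (z n). f w \<in> V \<and> n < to_nat_on E (f w)}" for n
  have R_top: "R n \<subseteq> topspace X" for n
    using z(1) by (auto simp: R_def)
  have R_cl: "t n \<in> X closure_of R n" for n
  proof (rule limitin_frequently_imp_closure_of[OF z(2)])
    \<comment> \<open>Thinning \<open>z n\<close> to \<open>R n\<close> loses only finitely many
      values: those of index at most \<open>n\<close> in \<open>E\<close>, and those outside the
      neighbourhood \<open>V\<close> of \<open>f (t n)\<close>.\<close>
    have "inj_on (to_nat_on E) (f ` range (z n))"
      using inj_on_to_nat_on[OF E] by (rule inj_on_subset) (auto simp: E_def)
    then have "finite {d \<in> f ` range (z n). to_nat_on E d \<in> {..n}}"
      by (metis finite_atMost finite_inverse_image_gen)
    moreover have "finite (f ` range (z n) - V)"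
      using finite_image_convergent_outside[OF Y f z(1,2) V] .
    ultimately have "infinite (f ` range (z n) - ({d \<in> f ` range (z n). to_nat_on E d \<in> {..n}} \<union> (f ` range (z n) - V)))"
      using z(3)[of n] by (meson Diff_infinite_finite finite_UnI)
    moreover have "f ` range (z n) - ({d \<in> f ` range (z n). to_nat_on E d \<in> {..n}} \<union> (f ` range (z n) - V))
        \<subseteq> (\<lambda>k. f (z n k)) ` {k. z n k \<in> R n}"
      by (auto simp: R_def not_le)
    ultimately show "infinite {k. z n k \<in> R n}"
      by (meson finite_imageI finite_subset)
  qed
  have R_fin: "finite {n. d \<in> f ` R n}" for d
    by (rule finite_subset[of _ "{..<to_nat_on E d}"]) (auto simp: R_def)
  obtain a where a: "range a \<subseteq> (\<Union>n. R n)" "limitin X a x sequentially" "infinite (f ` range a)"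
    using diagonal_infinite_image[OF sH Fr t(1,2) R_top R_cl R_fin] by metis
  have "range a \<subseteq> topspace X" "f ` range a \<subseteq> V"
    using a(1) R_top by (blast, force simp: R_def)
  with a show thesis
    using that by blast
qed

section \<open>Continuity on sets of spreading points\<close>

lemma continuous_map_spreading_points:
  assumes sH: "sequentially_Hausdorff X" and Fr: "Frechet_space X"
    and Y: "Hausdorff_space Y" and f: "compact_preserving_map X Y f"
    and S: "S \<subseteq> spreading_points X f" "S \<subseteq> topspace X"
  shows "continuous_map (subtopology X S) Y f"
  unfolding continuous_map_closedin
proof (intro conjI allI impI)
  have fun_f: "f \<in> topspace X \<rightarrow> topspace Y"
    using f by (simp add: compact_preserving_map_def)
  then show "f \<in> topspace (subtopology X S) \<rightarrow> topspace Y"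
    by auto
  fix C assume C: "closedin Y C"
  define A where "A = {z \<in> S. f z \<in> C}"
  have "X closure_of A \<inter> S \<subseteq> A"
  proof
    fix x assume x: "x \<in> X closure_of A \<inter> S"
    show "x \<in> A"
    proof (rule ccontr)
      assume "x \<notin> A"
      then have fx: "f x \<notin> C" "x \<in> topspace X" "f x \<in> topspace Y"
        using x S(2) fun_f by (auto simp: A_def)
      have "A \<subseteq> topspace X"
        using S(2) by (auto simp: A_def)
      then obtain t where t: "range t \<subseteq> A" "limitin X t x sequentially"
        using Frechet_spaceE[OF Fr _ IntD1[OF x]] by blast
      have t_top: "range t \<subseteq> topspace X"
        using t(1) \<open>A \<subseteq> topspace X\<close> by blast
      define F where "F = f ` range t"
      have "F \<subseteq> C"
        using t(1) by (auto simp: F_def A_def)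
      \<comment> \<open>All values of \<open>t\<close> lie outside this neighbourhood of
        \<open>f x\<close>, so there are only finitely many of them.\<close>
      have "openin Y (topspace Y - C)" "f x \<in> topspace Y - C"
        using C fx by blast+
      then have "finite (F - (topspace Y - C))"
        unfolding F_def by (rule finite_image_convergent_outside[OF Y f t_top t(2)])
      moreover have "F - (topspace Y - C) = F"
        using \<open>F \<subseteq> C\<close> by blast
      ultimately have "finite F"
        by simp
      moreover have "F \<subseteq> topspace Y"
        using \<open>F \<subseteq> C\<close> C closedin_subset by blast
      ultimately have "compactin Y F"
        by (simp add: finite_imp_compactin_eq)
      moreover have "compactin Y {f x}"
        using fx by simp
      \<comment> \<open>Since \<open>Y\<close> is merely Hausdorff, \<open>f x\<close> is separated
        from the finite set \<open>F\<close> instead of from \<open>C\<close>.\<close>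
      moreover have "disjnt F {f x}"
        using \<open>F \<subseteq> C\<close> fx by (auto simp: disjnt_def)
      ultimately obtain V W where VW: "openin Y V" "openin Y W" "F \<subseteq> V" "{f x} \<subseteq> W" "disjnt V W"
        using Hausdorff_space_compact_separation[OF Y] by metis
      have "t n \<noteq> x" "t n \<in> spreading_points X f" "f (t n) \<in> V" for n
        using t(1) \<open>x \<notin> A\<close> S(1) VW(3) by (auto simp: A_def F_def)
      then obtain a where a: "range a \<subseteq> topspace X" "limitin X a x sequentially"
          "infinite (f ` range a)" "f ` range a \<subseteq> V"
        using limit_of_spreading_points[OF sH Fr Y f t(2) _ _ VW(1)] by metis
      \<comment> \<open>The values of \<open>a\<close> lie in \<open>V\<close>, hence all of them
        miss the neighbourhood \<open>W\<close> of \<open>f x\<close>.\<close>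
      have "finite (f ` range a - W)"
        using finite_image_convergent_outside[OF Y f a(1,2) VW(2)] VW(4) by blast
      moreover have "f ` range a - W = f ` range a"
        using a(4) VW(5) by (auto simp: disjnt_def)
      ultimately show False
        using a(3) by simp
    qed
  qed
  moreover have "A \<subseteq> X closure_of A"
    using S(2) by (intro closure_of_subset) (auto simp: A_def)
  ultimately have "A = X closure_of A \<inter> S"
    by (auto simp: A_def)
  moreover have "{x \<in> topspace (subtopology X S). f x \<in> C} = A"
    using S(2) by (auto simp: A_def)
  ultimately show "closedin (subtopology X S) {x \<in> topspace (subtopology X S). f x \<in> C}"
    by (metis closedin_subtopology closedin_closure_of)
qed

section \<open>Locally infinite points and spreading\<close>

text \<open>Finitely many fibres cannot exhaust the values near \<open>x\<close>, so
  \<open>x\<close> stays adherent to the union \<open>A\<close> of the fibres not adherent to it. A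
  sequence in \<open>A\<close> converging to \<open>x\<close> takes finitely many values, because
  \<open>x\<close> is not spreading, so one of these fibres is adherent to \<open>x\<close> after
  all.\<close>

lemma infinite_adherent_fibres:
  assumes Fr: "Frechet_space X" and x: "x \<in> LI X f" "x \<notin> spreading_points X f"
  shows "infinite {d. x \<in> X closure_of {z \<in> topspace X. f z = d}}" (is "infinite ?D")
proof
  assume fin: "finite ?D"
  define A where "A = {z \<in> topspace X. f z \<notin> ?D}"
  have "x \<in> X closure_of A"
    unfolding in_closure_of
  proof (intro conjI allI impI)
    show "x \<in> topspace X"
      using x(1) by (simp add: LI_def)
  next
    fix T assume T: "x \<in> T \<and> openin X T"
    then have "infinite (f ` T)"
      using x(1) by (auto simp: LI_def locally_finite_map_at_def)
    then obtain y where "y \<in> T" "f y \<notin> ?D"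
      using fin by (meson finite_subset image_subsetI)
    then show "\<exists>y. y \<in> A \<and> y \<in> T"
      using T openin_subset by (fastforce simp: A_def)
  qed
  then obtain s where s: "range s \<subseteq> A" "limitin X s x sequentially"
    using Frechet_spaceE[OF Fr, of A x] by (auto simp: A_def)
  then have "finite (f ` range s)"
    using x(2) by (auto simp: spreading_points_def A_def)
  note cl_UN = closure_of_finite_UN[OF this, of X "\<lambda>d. {z \<in> topspace X. f z = d}"]
  have "range s \<subseteq> (\<Union>d\<in>f ` range s. {z \<in> topspace X. f z = d})"
    using s(1) by (auto simp: A_def)
  then have "x \<in> X closure_of (\<Union>d\<in>f ` range s. {z \<in> topspace X. f z = d})"
    using limitin_range_imp_closure_of[OF s(2)] closure_of_mono by blast
  then obtain d where "d \<in> f ` range s" "d \<in> ?D"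
    unfolding cl_UN by blast
  then show False
    using s(1) by (auto simp: A_def)
qed

lemma strong_Frechet_LI_subset_spreading_points:
  assumes sF: "strong_Frechet_space X"
  shows "LI X f \<subseteq> spreading_points X f"
proof
  fix x assume x: "x \<in> LI X f"
  show "x \<in> spreading_points X f"
  proof (rule ccontr)
    assume nx: "x \<notin> spreading_points X f"
    obtain d :: "nat \<Rightarrow> 'b" where d: "inj d" "range d \<subseteq> {d. x \<in> X closure_of {z \<in> topspace X. f z = d}}"
      using infinite_adherent_fibres[OF strong_Frechet_imp_Frechet_space[OF sF] x nx]
      unfolding infinite_iff_countable_subset by blast
    \<comment> \<open>\<open>A n\<close> is the union of the fibres over \<open>d i\<close> with
      \<open>i \<ge> n\<close>, so a sequence with \<open>s n \<in> A n\<close> cannot stay within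
      finitely many fibres.\<close>
    define A where "A n = {z \<in> topspace X. f z \<in> d ` {n..}}" for n
    have "decseq A"
      by (force simp: decseq_def A_def)
    moreover have "\<forall>n. A n \<subseteq> topspace X"
      by (auto simp: A_def)
    moreover have "x \<in> (\<Inter>n. X closure_of A n)"
    proof
      fix n
      have "x \<in> X closure_of {z \<in> topspace X. f z = d n}"
        using d(2) by blast
      moreover have "{z \<in> topspace X. f z = d n} \<subseteq> A n"
        by (auto simp: A_def)
      ultimately show "x \<in> X closure_of A n"
        using closure_of_mono by blast
    qed
    ultimately obtain s where s: "\<And>n. s n \<in> A n" "limitin X s x sequentially"
      using sF unfolding strong_Frechet_space_def by blast
    have "infinite (f ` range s)"
    proof
      assume "finite (f ` range s)"
      then have "finite (d -` (f ` range s))"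
        using d(1) by (rule finite_vimageI)
      then obtain N where N: "\<And>i. i \<in> d -` (f ` range s) \<Longrightarrow> i < N"
        unfolding finite_nat_set_iff_bounded by blast
      obtain i where "i \<ge> N" "f (s N) = d i"
        using s(1)[of N] by (auto simp: A_def)
      then have "i \<in> d -` (f ` range s)"
        by (metis imageI rangeI vimageI)
      with N \<open>i \<ge> N\<close> show False
        by fastforce
    qed
    moreover have "range s \<subseteq> topspace X"
      using s(1) by (auto simp: A_def)
    ultimately show False
      using nx s(2) by (auto simp: spreading_points_def)
  qed
qed

text \<open>Each choice need only avoid the finitely many earlier ones. This supplies pairwise
  different fibres as rows of the diagonal argument.\<close>

lemma distinct_representatives_of_infinite:
  fixes D :: "nat \<Rightarrow> 'b set"
  assumes "\<And>n. infinite (D n)"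
  obtains d where "inj d" "\<And>n. d n \<in> D n"
proof -
  have "\<exists>d. \<forall>n. d n \<in> D n \<and> d n \<notin> d ` {..<n}"
  proof (rule dependent_wellorder_choice)
    show "\<exists>r. r \<in> D n \<and> r \<notin> e ` {..<n}" for n and e :: "nat \<Rightarrow> 'b"
      using assms[of n] by (meson finite_imageI finite_lessThan finite_subset subsetI)
  qed (metis image_cong lessThan_iff)
  then obtain d where d: "\<And>n. d n \<in> D n" "\<And>n. d n \<notin> d ` {..<n}"
    by blast
  have "inj d"
    by (rule linorder_injI) (metis d(2) image_eqI lessThan_iff)
  with d(1) show thesis
    using that by blast
qed

lemma Frechet_LI'_subset_spreading_points:
  assumes sH: "sequentially_Hausdorff X" and Fr: "Frechet_space X"
    and Y: "Hausdorff_space Y" and f: "compact_preserving_map X Y f"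
  shows "LI' X f \<subseteq> spreading_points X f"
proof
  fix x assume x: "x \<in> LI' X f"
  let ?G = "spreading_points X f"
  have LI_top: "LI X f \<subseteq> topspace X"
    by (auto simp: LI_def)
  have xL: "x \<in> LI X f" and not_open: "\<not> openin (subtopology X (LI X f)) {x}"
    using x by (auto simp: LI'_def)
  have "x \<in> X closure_of (LI X f - {x})"
    unfolding in_closure_of
  proof (intro conjI allI impI)
    show "x \<in> topspace X"
      using xL LI_top by blast
  next
    fix T assume T: "x \<in> T \<and> openin X T"
    show "\<exists>y. y \<in> LI X f - {x} \<and> y \<in> T"
    proof (rule ccontr)
      assume "\<nexists>y. y \<in> LI X f - {x} \<and> y \<in> T"
      then have "{x} = T \<inter> LI X f"
        using xL T by blast
      then show False
        using not_open T by (metis openin_subtopology)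
    qed
  qed
  then have "x \<in> X closure_of ((LI X f \<inter> ?G - {x}) \<union> (LI X f - ?G - {x}))"
    by (rule rev_subsetD) (rule closure_of_mono, blast)
  \<comment> \<open>Either spreading points or non-spreading points of \<open>LI X f\<close>
    accumulate at \<open>x\<close>. The rows are convergent sequences in the first case and whole
    fibres in the second.\<close>
  then consider "x \<in> X closure_of (LI X f \<inter> ?G - {x})" | "x \<in> X closure_of (LI X f - ?G - {x})"
    by auto
  then show "x \<in> ?G"
  proof cases
    case 1
    then obtain t where t: "range t \<subseteq> LI X f \<inter> ?G - {x}" "limitin X t x sequentially"
      using Frechet_spaceE[OF Fr _ 1] LI_top by blast
    have "t n \<noteq> x" "t n \<in> ?G" "f (t n) \<in> topspace Y" for n
      using t(1) LI_top f by (auto simp: compact_preserving_map_def)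
    then obtain a where "range a \<subseteq> topspace X" "limitin X a x sequentially" "infinite (f ` range a)"
      using limit_of_spreading_points[OF sH Fr Y f t(2) _ _ openin_topspace] by metis
    then show ?thesis
      by (auto simp: spreading_points_def)
  next
    case 2
    then obtain t where t: "range t \<subseteq> LI X f - ?G - {x}" "limitin X t x sequentially"
      using Frechet_spaceE[OF Fr _ 2] LI_top by blast
    then have "infinite {d. t n \<in> X closure_of {z \<in> topspace X. f z = d}}" for n
      by (intro infinite_adherent_fibres[OF Fr]) auto
    then obtain d where d: "inj d" "\<And>n. d n \<in> {d. t n \<in> X closure_of {z \<in> topspace X. f z = d}}"
      using distinct_representatives_of_infinite[of "\<lambda>n. {d. t n \<in> X closure_of {z \<in> topspace X. f z = d}}"]
      by blast
    \<comment> \<open>As \<open>d\<close> is injective, each value occurs in at most one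
      row.\<close>
    define R where "R n = {z \<in> topspace X. f z = d n}" for n
    have "R n \<subseteq> topspace X" "t n \<in> X closure_of R n" "t n \<noteq> x" for n
      using d(2) t(1) by (auto simp: R_def)
    moreover have "finite {n. e \<in> f ` R n}" for e
    proof (rule finite_subset)
      show "{n. e \<in> f ` R n} \<subseteq> d -` {e}"
        by (auto simp: R_def)
      show "finite (d -` {e})"
        using d(1) by (simp add: finite_vimageI)
    qed
    ultimately obtain a where "range a \<subseteq> (\<Union>n. R n)" "limitin X a x sequentially" "infinite (f ` range a)"
      using diagonal_infinite_image[OF sH Fr t(2)] by metis
    moreover from this have "range a \<subseteq> topspace X"
      by (auto simp: R_def)
    ultimately show ?thesis
      by (auto simp: spreading_points_def)
  qed
qed

theorem corollary3:
  fixes X :: "'a topology" and Y :: "'b topology" and f :: "'a \<Rightarrow> 'b"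
  assumes "sequentially_Hausdorff X"
    and "Hausdorff_space Y"
    and "compact_preserving_map X Y f"
  shows "(Frechet_space X \<longrightarrow> continuous_map (subtopology X (LI' X f)) Y f) \<and>
         (strong_Frechet_space X \<longrightarrow> continuous_map (subtopology X (LI X f)) Y f)"
proof (intro conjI impI)
  assume Fr: "Frechet_space X"
  show "continuous_map (subtopology X (LI' X f)) Y f"
    by (rule continuous_map_spreading_points[OF assms(1) Fr assms(2,3)
          Frechet_LI'_subset_spreading_points[OF assms(1) Fr assms(2,3)]])
       (auto simp: LI'_def LI_def)
next
  assume sF: "strong_Frechet_space X"
  show "continuous_map (subtopology X (LI X f)) Y f"
    by (rule continuous_map_spreading_points[OF assms(1) strong_Frechet_imp_Frechet_space[OF sF] assms(2,3)
          strong_Frechet_LI_subset_spreading_points[OF sF]])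
       (auto simp: LI_def)
qed

end
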